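(* Let $K_n$ be the complete graph with vertex set $V$, $|V|=n\ge 3$. Call a uniform representation of $K_n$ of type (N) if it has the form $S_v=\{c,x_v\}$ ($v\in V$) with $c$ a common element and the $x_v$ pairwise distinct elements different from $c$; call it of type (P) if there is a projective plane of order $k$ with point set $V$ and $S_v$ is the set of lines through $v$; call it of type (P$^-$) if there is a projective plane of order $k$ whose point set is $V\cup\{p\}$ with $p\notin V$ and $S_v$ is the set of lines of that plane through $v$; and for $n=3$ call it of type (T) if it is $\{a,b\},\{a,c\},\{b,c\}$ for three distinct elements $a,b,c$. Then: (1) for $n=3$, $\omega_u(K_3)=3$ and all minimum uniform representations of $K_3$ are of the single type (T); (2) for $n\ge 4$ with $n=k^2+k+1$ for some $k\ge 2$ such that a projective plane of order $k$ exists, $\omega_u(K_n)=n$ and all minimum uniform representations are of the single type (P); (3) for $n\ge 4$ with $n=k^2+k$ for some $k\ge 2$ such that a projective plane of order $k$ exists, $\omega_u(K_n)=n+1$ and the minimum uniform representations are of exactly two types, (N) and (P$^-$); (4) for $n\ge 4$ with $n\ne k^2+k+1$ and $n\neq k^2+k$ for all $k\ge 2$, $\omega_u(K_n)=n+1$ and all minimum uniform representations are of the single type (N).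
   Context: All graphs are finite, simple and undirected. For a finite family $\mathcal{F}$ of nonempty finite sets write $\mathbf{S}(\mathcal{F})=\bigcup_{S\in\mathcal{F}}S$. A representation of a graph $G$ is an assignment $v\mapsto S_v$ of a nonempty finite set to each vertex such that for all distinct vertices $u,v$, $|S_u\cap S_v|=1$ if $uv$ is an edge and $|S_u\cap S_v|=0$ otherwise. It is a uniform representation if the sets $S_v$ are pairwise distinct and all have the same cardinality. The uniform intersection number $\omega_u(G)$ is the minimum of $|\mathbf{S}(\mathcal{F})|$ over all uniform representations $\mathcal{F}$ of $G$; a minimum uniform representation is one attaining this minimum. A (finite) projective plane is a finite set of points with a family of subsets called lines such that every line has at least two points, any two distinct points lie on exactly one line, any two distinct lines meet in a point, and there exist four points no three on a common line; it has order $k\ge 2$ if it has $k^2+k+1$ points, $k^2+k+1$ lines, each line has $k+1$ points and each point lies on $k+1$ lines. In the statement, "type" refers to the forms of representation described in the claim (up to the choice of the underlying elements). *)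

theory Defs
  imports Main "Graph_Theory.Graph_Theory"
begin

text \<open>
  Graphs are the symmetric, loop-free and multi-arc-free finite digraphs of \<^locale>\<open>graph\<close>;
  an edge \<open>uv\<close> is a pair of opposite arcs. A family \<open>(S v)\<close> indexed by the vertices is a
  function of which only the values on \<^term>\<open>verts G\<close> matter.
\<close>

definition representation :: "('v, 'e) pre_digraph \<Rightarrow> ('v \<Rightarrow> 'b set) \<Rightarrow> bool" where
  "representation G S \<longleftrightarrow>
     (\<forall>v\<in>verts G. finite (S v) \<and> S v \<noteq> {}) \<and>
     (\<forall>u\<in>verts G. \<forall>v\<in>verts G. u \<noteq> v \<longrightarrow>
        card (S u \<inter> S v) = (if u \<rightarrow>\<^bsub>G\<^esub> v then 1 else 0))"

definition uniform_representation :: "('v, 'e) pre_digraph \<Rightarrow> ('v \<Rightarrow> 'b set) \<Rightarrow> bool" where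
  "uniform_representation G S \<longleftrightarrow>
     representation G S \<and> inj_on S (verts G) \<and>
     (\<forall>u\<in>verts G. \<forall>v\<in>verts G. card (S u) = card (S v))"

text \<open>
  The minimum ranges over representations by sets of natural numbers. The sets of a
  representation are finite, so their elements can always be renamed to natural numbers;
  lemmas \<open>omega_u_le\<close> and \<open>omega_u_attained\<close> below confirm that this is the minimum over
  representations with elements of any type.
\<close>

definition omega_u :: "('v, 'e) pre_digraph \<Rightarrow> nat" where
  "omega_u G = Inf {card (\<Union>v\<in>verts G. S v) | S :: 'v \<Rightarrow> nat set. uniform_representation G S}"

definition min_uniform_representation :: "('v, 'e) pre_digraph \<Rightarrow> ('v \<Rightarrow> 'b set) \<Rightarrow> bool" where
  "min_uniform_representation G S \<longleftrightarrow>
     uniform_representation G S \<and> card (\<Union>v\<in>verts G. S v) = omega_u G"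

definition projective_plane :: "'p set \<Rightarrow> 'p set set \<Rightarrow> bool" where
  "projective_plane P L \<longleftrightarrow>
     finite P \<and> L \<subseteq> Pow P \<and>
     (\<forall>l\<in>L. card l \<ge> 2) \<and>
     (\<forall>x\<in>P. \<forall>y\<in>P. x \<noteq> y \<longrightarrow> (\<exists>!l. l \<in> L \<and> x \<in> l \<and> y \<in> l)) \<and>
     (\<forall>l\<in>L. \<forall>m\<in>L. l \<noteq> m \<longrightarrow> (\<exists>x\<in>P. x \<in> l \<and> x \<in> m)) \<and>
     (\<exists>Q\<subseteq>P. card Q = 4 \<and> (\<forall>T\<subseteq>Q. card T = 3 \<longrightarrow> \<not> (\<exists>l\<in>L. T \<subseteq> l)))"

definition projective_plane_of_order :: "nat \<Rightarrow> 'p set \<Rightarrow> 'p set set \<Rightarrow> bool" where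
  "projective_plane_of_order k P L \<longleftrightarrow>
     projective_plane P L \<and> k \<ge> 2 \<and>
     card P = k\<^sup>2 + k + 1 \<and> card L = k\<^sup>2 + k + 1 \<and>
     (\<forall>l\<in>L. card l = k + 1) \<and>
     (\<forall>x\<in>P. card {l \<in> L. x \<in> l} = k + 1)"

definition projective_plane_exists :: "nat \<Rightarrow> bool" where
  "projective_plane_exists k \<longleftrightarrow>
     (\<exists>(P :: nat set) L. projective_plane_of_order k P L)"

definition type_T :: "'v set \<Rightarrow> ('v \<Rightarrow> 'b set) \<Rightarrow> bool" where
  "type_T V S \<longleftrightarrow> (\<exists>a b c. distinct [a, b, c] \<and> S ` V = {{a, b}, {a, c}, {b, c}})"

definition type_N :: "'v set \<Rightarrow> ('v \<Rightarrow> 'b set) \<Rightarrow> bool" where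
  "type_N V S \<longleftrightarrow>
     (\<exists>c x. inj_on x V \<and> (\<forall>v\<in>V. x v \<noteq> c \<and> S v = {c, x v}))"

text \<open>
  Types are understood up to the choice of the underlying elements: the injection \<open>f\<close>
  names each line of the plane by an element of the representing sets.
\<close>

definition type_P :: "nat \<Rightarrow> 'v set \<Rightarrow> ('v \<Rightarrow> 'b set) \<Rightarrow> bool" where
  "type_P k V S \<longleftrightarrow>
     (\<exists>L f. projective_plane_of_order k V L \<and> inj_on f L \<and>
        (\<forall>v\<in>V. S v = f ` {l \<in> L. v \<in> l}))"

text \<open>
  The vertex type may contain no element outside \<open>V\<close>, so the additional point \<open>p\<close> is
  \<^const>\<open>None\<close> and the vertices are embedded by \<^const>\<open>Some\<close>.
\<close>

definition type_P_minus :: "nat \<Rightarrow> 'v set \<Rightarrow> ('v \<Rightarrow> 'b set) \<Rightarrow> bool" where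
  "type_P_minus k V S \<longleftrightarrow>
     (\<exists>L f. projective_plane_of_order k (insert None (Some ` V)) L \<and> inj_on f L \<and>
        (\<forall>v\<in>V. S v = f ` {l \<in> L. Some v \<in> l}))"

lemma uniform_representation_rename:
  assumes fin: "finite (verts G)" and S: "uniform_representation G S"
  obtains T :: "'v \<Rightarrow> nat set" where "uniform_representation G T"
    and "card (\<Union>v\<in>verts G. T v) = card (\<Union>v\<in>verts G. S (v :: 'v))"
proof -
  let ?U = "\<Union>v\<in>verts G. S v"
  have S1: "\<forall>v\<in>verts G. finite (S v) \<and> S v \<noteq> {}"
    and S2: "\<And>u v. u \<in> verts G \<Longrightarrow> v \<in> verts G \<Longrightarrow> u \<noteq> v \<Longrightarrow>
      card (S u \<inter> S v) = (if u \<rightarrow>\<^bsub>G\<^esub> v then 1 else 0)"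
    and S3: "inj_on S (verts G)"
    and S4: "\<And>u v. u \<in> verts G \<Longrightarrow> v \<in> verts G \<Longrightarrow> card (S u) = card (S v)"
    using S unfolding uniform_representation_def representation_def by blast+
  have "finite ?U"
    using fin S1 by blast
  from finite_imp_inj_to_nat_seg[OF this] obtain f :: "_ \<Rightarrow> nat" where f: "inj_on f ?U"
    by blast
  have sub: "S v \<subseteq> ?U" if "v \<in> verts G" for v using that by blast
  have card: "card (f ` A) = card A" if "A \<subseteq> ?U" for A
    by (rule card_image[OF inj_on_subset[OF f that]])
  have int: "f ` S u \<inter> f ` S v = f ` (S u \<inter> S v)" if "u \<in> verts G" "v \<in> verts G" for u v
    using inj_on_image_Int[OF f sub sub] that by simp
  have cint: "card (f ` S u \<inter> f ` S v) = card (S u \<inter> S v)"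
    if "u \<in> verts G" "v \<in> verts G" for u v
    unfolding int[OF that] by (rule card) (use that in blast)
  have inj: "inj_on (\<lambda>v. f ` S v) (verts G)"
  proof (rule inj_onI)
    fix u v assume uv: "u \<in> verts G" "v \<in> verts G" "f ` S u = f ` S v"
    then have "S u = S v" using inj_on_image_eq_iff[OF f sub[OF uv(1)] sub[OF uv(2)]] by simp
    then show "u = v" by (rule inj_onD[OF S3 _ uv(1,2)])
  qed
  have "uniform_representation G (\<lambda>v. f ` S v)"
    unfolding uniform_representation_def representation_def
  proof (intro conjI ballI impI inj)
    fix u v assume uv: "u \<in> verts G" "v \<in> verts G"
    show "card (f ` S u) = card (f ` S v)"
      unfolding card[OF sub[OF uv(1)]] card[OF sub[OF uv(2)]] by (rule S4[OF uv])
    show "card (f ` S u \<inter> f ` S v) = (if u \<rightarrow>\<^bsub>G\<^esub> v then 1 else 0)" if "u \<noteq> v"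
      unfolding cint[OF uv] by (rule S2[OF uv that])
  qed (use S1 in auto)
  moreover have "card (\<Union>v\<in>verts G. f ` S v) = card ?U"
    using card[of ?U] by (simp add: image_UN)
  ultimately show ?thesis using that by blast
qed

lemma omega_u_le:
  assumes "finite (verts G)" "uniform_representation G S"
  shows "omega_u G \<le> card (\<Union>v\<in>verts G. S v)"
proof -
  obtain T :: "_ \<Rightarrow> nat set" where "uniform_representation G T"
    and c: "card (\<Union>v\<in>verts G. T v) = card (\<Union>v\<in>verts G. S v)"
    using uniform_representation_rename[OF assms] .
  then show ?thesis
    unfolding omega_u_def c[symmetric] by (intro cInf_lower) auto
qed

lemma uniform_representation_ex:
  assumes "graph G"
  shows "\<exists>S :: 'v \<Rightarrow> nat set. uniform_representation (G :: ('v, 'e) pre_digraph) S"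
proof -
  interpret graph G by fact
  let ?V = "verts G"
  define N where "N v = {w \<in> ?V. w \<noteq> v \<and> v \<rightarrow>\<^bsub>G\<^esub> w}" for v
  define A where "A v = (\<lambda>w. {v, w}) ` N v" for v
  define S :: "'v \<Rightarrow> ('v set + 'v \<times> nat) set" where
    "S v = Inl ` A v \<union> Inr ` ({v} \<times> {..card ?V - card (N v)})" for v
  have sym: "u \<rightarrow>\<^bsub>G\<^esub> v \<longleftrightarrow> v \<rightarrow>\<^bsub>G\<^esub> u" for u v
    using sym_arcs unfolding symmetric_def by (auto dest: symD)
  have finN: "finite (N v)" for v by (simp add: N_def)
  then have fin: "finite (S v)" for v by (simp add: S_def A_def)
  have leN: "card (N v) \<le> card ?V" for v
    by (rule card_mono) (auto simp: N_def)
  have cA: "card (A v) = card (N v)" for v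
    unfolding A_def by (rule card_image) (auto simp: inj_on_def doubleton_eq_iff)
  have cS: "card (S v) = card ?V + 1" for v
  proof -
    have "card (S v) = card (Inl ` A v :: ('v set + 'v \<times> nat) set)
        + card (Inr ` ({v} \<times> {..card ?V - card (N v)}) :: ('v set + 'v \<times> nat) set)"
      unfolding S_def by (rule card_Un_disjoint) (auto simp: A_def finN)
    also have "\<dots> = card ?V + 1"
      using cA[of v] leN[of v] by (simp add: card_image card_cartesian_product)
    finally show ?thesis .
  qed
  have int: "S u \<inter> S v = (if u \<rightarrow>\<^bsub>G\<^esub> v then {Inl {u, v}} else {})"
    if "u \<in> ?V" "v \<in> ?V" "u \<noteq> v" for u v
    using that sym[of u v] by (auto simp: S_def A_def N_def doubleton_eq_iff)
  have inj: "inj_on S ?V"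
  proof (rule inj_onI)
    fix u v assume "S u = S v"
    moreover have "Inr (u, 0) \<in> S u" by (auto simp: S_def)
    ultimately have "Inr (u, 0) \<in> S v" by simp
    then show "u = v" by (auto simp: S_def)
  qed
  have "S v \<noteq> {}" for v by (auto simp: S_def)
  then have "uniform_representation G S"
    using fin int inj cS by (auto simp: uniform_representation_def representation_def)
  from uniform_representation_rename[OF _ this] show ?thesis by auto
qed

lemma omega_u_attained:
  assumes "graph G"
  shows "\<exists>S :: 'v \<Rightarrow> nat set. min_uniform_representation (G :: ('v, 'e) pre_digraph) S"
proof -
  have "omega_u G \<in> {card (\<Union>v\<in>verts G. S v) | S :: 'v \<Rightarrow> nat set. uniform_representation G S}"
    unfolding omega_u_def by (rule Inf_nat_def1) (use uniform_representation_ex[OF assms] in auto)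
  then show ?thesis by (auto simp: min_uniform_representation_def)
qed

end

theory Submission
  imports Defs
begin

text \<open>
  Let the sets \<open>S v\<close> have size \<open>r\<close>, and let an element \<open>x\<close> of their union \<open>U\<close> stand for the
  line \<open>{v. x \<in> S v}\<close>. If some element lies in all sets, then \<open>|U| = 1 + n (r - 1)\<close>, which is at
  least \<open>n + 1\<close> with equality only for type (N). Otherwise the sets through \<open>x\<close> cut a set avoiding
  \<open>x\<close> in distinct elements, so every line has at most \<open>r\<close> points, and counting incidences gives
  \<open>n \<le> |U|\<close>, with equality only if all lines have exactly \<open>r\<close> points; two lines then meet, and
  the lines form a projective plane of order \<open>r - 1\<close>.

  If \<open>|U| = n + 1\<close>, the deficiencies \<open>e x = r - |line x| \<ge> 0\<close> sum to \<open>r\<close>, and their sum over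
  \<open>S v\<close> is a constant \<open>c = r (r - 1) - (n - 1)\<close>. Double counting gives
  \<open>n c = r\<^sup>2 - (\<Sum>x. (e x)\<^sup>2)\<close>. Since \<open>r \<le> (\<Sum>x. (e x)\<^sup>2) < r\<^sup>2\<close>, this forces \<open>c = 1\<close> and
  \<open>e x \<in> {0, 1}\<close>; joining the deficient lines in a new point yields a projective plane.
\<close>

section \<open>Families of \<open>r\<close>-sets meeting pairwise in one element\<close>

lemma two_elements:
  assumes "card A \<ge> 2"
  obtains x y where "x \<in> A" "y \<in> A" "x \<noteq> y"
proof -
  have "finite A" using assms by (intro card_ge_0_finite) simp
  then have "\<not> (\<forall>x\<in>A. \<forall>y\<in>A. x = y)"
    using assms card_le_Suc0_iff_eq[of A] by simp
  then show ?thesis using that by blast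
qed

text \<open>The index set is arbitrary rather than the vertex set of a graph, so that the locale can
  be interpreted again with one more index. Distinctness of the sets is not assumed: it follows from
  \<open>r_ge_2\<close> and \<open>card_Int\<close>.\<close>

locale clique_family =
  fixes V :: "'v set" and S :: "'v \<Rightarrow> 'b set" and r :: nat
  assumes finite_V: "finite V"
    and r_ge_2: "r \<ge> 2"
    and card_S: "v \<in> V \<Longrightarrow> card (S v) = r"
    and card_Int: "u \<in> V \<Longrightarrow> v \<in> V \<Longrightarrow> u \<noteq> v \<Longrightarrow> card (S u \<inter> S v) = 1"
begin

definition U :: "'b set" where
  "U = (\<Union>v\<in>V. S v)"

definition line :: "'b \<Rightarrow> 'v set" where
  "line x = {v \<in> V. x \<in> S v}"

lemma finite_S: "v \<in> V \<Longrightarrow> finite (S v)"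
  using card_S r_ge_2 by (metis card.infinite not_numeral_le_zero)

lemma finite_U: "finite U"
  using finite_V finite_S by (auto simp: U_def)

lemma finite_line: "finite (line x)"
  using finite_V by (simp add: line_def)

lemma S_subset_U: "v \<in> V \<Longrightarrow> S v \<subseteq> U"
  by (auto simp: U_def)

lemma card_line_pos: "x \<in> U \<Longrightarrow> card (line x) > 0"
  using finite_line by (auto simp: U_def line_def card_gt_0_iff)

lemma common_element:
  assumes "u \<in> V" "v \<in> V" "u \<noteq> v"
  obtains x where "S u \<inter> S v = {x}"
  using card_Int[OF assms] by (auto simp: card_1_singleton_iff)

lemma common_element_unique:
  assumes "u \<in> V" "v \<in> V" "u \<noteq> v" "x \<in> S u" "x \<in> S v" "y \<in> S u" "y \<in> S v"
  shows "x = y"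
  using common_element[OF assms(1-3)] assms(4-7) by (metis IntI singletonD)

text \<open>Exchange of summation over the incident pairs \<open>(v, x)\<close>. The weight
  \<open>g\<close> stays general, since it is first the constant 1 and later the deficiency of a
  line.\<close>

lemma sum_incidence:
  fixes g :: "'b \<Rightarrow> 'c::comm_semiring_1"
  shows "(\<Sum>v\<in>V. \<Sum>x\<in>S v. g x) = (\<Sum>x\<in>U. of_nat (card (line x)) * g x)"
proof -
  have "(\<Sum>v\<in>V. \<Sum>x\<in>S v. g x) = (\<Sum>v\<in>V. \<Sum>x | x \<in> U \<and> x \<in> S v. g x)"
    using S_subset_U by (intro sum.cong refl) auto
  also have "\<dots> = (\<Sum>x\<in>U. \<Sum>v | v \<in> V \<and> x \<in> S v. g x)"
    by (rule sum.swap_restrict[OF finite_V finite_U])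
  finally show ?thesis
    by (simp add: line_def)
qed

lemma sum_card_line: "(\<Sum>x\<in>U. card (line x)) = card V * r"
  using sum_incidence[of "\<lambda>_. 1::nat"] card_S by simp

text \<open>Every index other than \<open>v\<close> shares exactly one element with
  \<open>S v\<close>, so the lines through \<open>v\<close>, with \<open>v\<close> removed,
  partition the remaining indices.\<close>

lemma sum_card_line_S:
  assumes v: "v \<in> V"
  shows "(\<Sum>x\<in>S v. int (card (line x)) - 1) = int (card V) - 1"
proof -
  have "V - {v} = (\<Union>x\<in>S v. line x - {v})"
  proof (intro equalityI subsetI)
    fix u assume u: "u \<in> V - {v}"
    then obtain x where "S u \<inter> S v = {x}" using common_element[of u v] v by blast
    then show "u \<in> (\<Union>x\<in>S v. line x - {v})" using u by (auto simp: line_def)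
  qed (auto simp: line_def)
  moreover have "card (\<Union>x\<in>S v. line x - {v}) = (\<Sum>x\<in>S v. card (line x - {v}))"
  proof (rule card_UN_disjoint[OF finite_S[OF v]])
    show "\<forall>x\<in>S v. \<forall>y\<in>S v. x \<noteq> y \<longrightarrow> (line x - {v}) \<inter> (line y - {v}) = {}"
      using common_element_unique[OF _ v] by (fastforce simp: line_def)
  qed (simp add: finite_line)
  ultimately have "card (V - {v}) = (\<Sum>x\<in>S v. card (line x - {v}))" by simp
  moreover have "int (card (line x - {v})) = int (card (line x)) - 1" if "x \<in> S v" for x
  proof -
    have "v \<in> line x" using that v by (simp add: line_def)
    then show ?thesis
      using card_Suc_Diff1[OF finite_line] by (metis add_diff_cancel_left' of_nat_Suc)
  qed
  moreover have "int (card (V - {v})) = int (card V) - 1"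
    using card_Suc_Diff1[OF finite_V v] by linarith
  ultimately show ?thesis
    by simp
qed

text \<open>\<open>f\<close> sends \<open>u\<close> to the element common to \<open>S u\<close> and
  \<open>S v\<close>. If two sets through \<open>x\<close> had the same image, they would share it
  besides \<open>x\<close>, which lies outside \<open>S v\<close>. The last property of
  \<open>f\<close> serves to trace an image back to its set in \<open>lines_meet\<close>.\<close>

lemma line_projection:
  assumes v: "v \<in> V" and x: "x \<notin> S v"
  obtains f where "inj_on f (line x)" "f ` line x \<subseteq> S v" "\<And>u. u \<in> line x \<Longrightarrow> f u \<in> S u"
proof
  define f where "f u = (SOME y. y \<in> S u \<inter> S v)" for u
  have f: "f u \<in> S u \<inter> S v" if "u \<in> line x" for u
  proof -
    have "u \<in> V" "u \<noteq> v" using that x by (auto simp: line_def)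
    then obtain y where "S u \<inter> S v = {y}" using common_element[of u v] v by blast
    then show ?thesis unfolding f_def by simp
  qed
  then show "f ` line x \<subseteq> S v" "\<And>u. u \<in> line x \<Longrightarrow> f u \<in> S u" by auto
  show "inj_on f (line x)"
  proof (rule inj_onI, rule ccontr)
    fix u w assume uw: "u \<in> line x" "w \<in> line x" "f u = f w" "u \<noteq> w"
    then have "f u = x"
      using f[OF uw(1)] f[OF uw(2)] by (intro common_element_unique[of u w]) (auto simp: line_def)
    then show False using f[OF uw(1)] x by simp
  qed
qed

lemma card_line_le:
  assumes "v \<in> V" "x \<notin> S v"
  shows "card (line x) \<le> r"
  using line_projection[OF assms] card_inj_on_le finite_S card_S assms(1) by metis

text \<open>Take \<open>v\<close> with \<open>x\<close> in \<open>S v\<close> and \<open>y\<close>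
  not in \<open>S v\<close>. The projection of \<open>line y\<close> into \<open>S v\<close> is
  injective between sets of equal size \<open>r\<close>, hence onto, and the index projecting to
  \<open>x\<close> lies on both lines.\<close>

lemma lines_meet:
  assumes reg: "\<And>z. z \<in> U \<Longrightarrow> card (line z) = r" and x: "x \<in> U" and y: "y \<in> U"
  shows "line x \<inter> line y \<noteq> {}"
proof -
  obtain v where v: "v \<in> V" "x \<in> S v" using x by (auto simp: U_def)
  show ?thesis
  proof (cases "y \<in> S v")
    case True
    then show ?thesis using v by (auto simp: line_def)
  next
    case False
    obtain f where f: "inj_on f (line y)" "f ` line y \<subseteq> S v" "\<And>u. u \<in> line y \<Longrightarrow> f u \<in> S u"
      using line_projection[OF v(1) False] by blast
    have "f ` line y = S v"
      using f v(1) finite_S by (intro card_subset_eq) (auto simp: card_image reg y card_S)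
    then have "x \<in> f ` line y" using v(2) by simp
    then obtain u where "u \<in> line y" "x = f u" by (rule imageE)
    then show ?thesis using f(3)[of u] by (auto simp: line_def)
  qed
qed

text \<open>Outside \<open>c\<close> the sets are pairwise disjoint, which fixes
  \<open>card U\<close>. An excess of at most one over \<open>card V\<close> forces
  \<open>r = 2\<close>, so each set is \<open>c\<close> with one private element.\<close>

lemma star_imp_type_N:
  assumes c: "\<And>v. v \<in> V \<Longrightarrow> c \<in> S v" and V: "V \<noteq> {}"
  shows "card V < card U"
    and "card U \<le> card V + 1 \<Longrightarrow> type_N V S"
proof -
  have U_eq: "U - {c} = (\<Union>v\<in>V. S v - {c})" by (auto simp: U_def)
  have cU: "c \<in> U" using c V by (auto simp: U_def)
  have "card (U - {c}) = (\<Sum>v\<in>V. card (S v - {c}))"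
    unfolding U_eq
  proof (rule card_UN_disjoint[OF finite_V])
    show "\<forall>i\<in>V. \<forall>j\<in>V. i \<noteq> j \<longrightarrow> (S i - {c}) \<inter> (S j - {c}) = {}"
      using c common_element_unique by blast
  qed (use finite_S in auto)
  also have "\<dots> = card V * (r - 1)" using c card_S finite_S by simp
  finally have eq: "card U = card V * (r - 1) + 1"
    using card_Suc_Diff1[OF finite_U cU] by simp
  have "card V * 1 \<le> card V * (r - 1)" using r_ge_2 by (intro mult_le_mono) auto
  then show "card V < card U" unfolding eq by linarith
  assume "card U \<le> card V + 1"
  then have "card V * (r - 1) \<le> card V * 1" using eq by simp
  then have r: "r = 2" using V finite_V r_ge_2 by (simp add: card_gt_0_iff)
  have "\<exists>x. S v = {c, x} \<and> x \<noteq> c" if "v \<in> V" for v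
    using card_S[OF that] c[OF that] r by (auto simp: card_2_iff)
  then obtain x where x: "\<And>v. v \<in> V \<Longrightarrow> S v = {c, x v} \<and> x v \<noteq> c" by metis
  have "inj_on x V"
  proof (rule inj_onI, rule ccontr)
    fix u v assume uv: "u \<in> V" "v \<in> V" "x u = x v" "u \<noteq> v"
    have "x u = c" using uv x by (intro common_element_unique[OF uv(1,2,4)]) auto
    then show False using x uv by blast
  qed
  then show "type_N V S" using x by (auto simp: type_N_def)
qed

section \<open>Regular families and projective planes\<close>

lemma regular_card:
  assumes reg: "\<And>x. x \<in> U \<Longrightarrow> card (line x) = r" and V: "V \<noteq> {}"
  shows "card V = (r - 1)\<^sup>2 + (r - 1) + 1"
proof -
  obtain v where v: "v \<in> V" using V by blast
  obtain k where k: "r = Suc k" using r_ge_2 by (cases r) auto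
  \<comment> \<open>In the count around \<open>v\<close> each of the \<open>r\<close> summands
    equals \<open>r - 1\<close>.\<close>
  have "int r * (int r - 1) = (\<Sum>x\<in>S v. int (card (line x)) - 1)"
    using reg S_subset_U[OF v] card_S[OF v] by (simp add: subset_iff)
  also have "\<dots> = int (card V) - 1" by (rule sum_card_line_S[OF v])
  finally have "int (card V) = int (k\<^sup>2 + k + 1)"
    by (simp add: k power2_eq_square algebra_simps)
  then show ?thesis unfolding k by (simp flip: of_nat_eq_iff del: of_nat_add of_nat_power)
qed

lemma inj_on_line:
  assumes reg: "\<And>x. x \<in> U \<Longrightarrow> card (line x) = r"
  shows "inj_on line U"
proof (rule inj_onI)
  fix x y assume xy: "x \<in> U" "y \<in> U" "line x = line y"
  have "card (line x) \<ge> 2" using reg xy r_ge_2 by simp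
  then obtain u v where "u \<in> line x" "v \<in> line x" "u \<noteq> v"
    by (rule two_elements)
  then show "x = y"
    using xy(3) by (intro common_element_unique[of u v]) (auto simp: line_def)
qed

text \<open>The points are the indices and the lines are the sets \<open>line x\<close>. Two points
  span one line because two sets share one element, and two lines meet by \<open>lines_meet\<close>.
  The bound \<open>r \<ge> 3\<close> leaves two points besides \<open>p\<close> on every line
  through \<open>p\<close>, which yields the quadrangle.\<close>

lemma regular_imp_type_P:
  assumes reg: "\<And>x. x \<in> U \<Longrightarrow> card (line x) = r" and card_U: "card U = card V" and r: "r \<ge> 3"
    and V: "V \<noteq> {}"
  shows "type_P (r - 1) V S"
proof -
  let ?L = "line ` U"
  have inj: "inj_on line U" by (rule inj_on_line[OF reg])
  have line_eq: "line x = line y"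
    if "u \<in> V" "v \<in> V" "u \<noteq> v" "u \<in> line x" "v \<in> line x" "u \<in> line y" "v \<in> line y" for u v x y
    using common_element_unique[OF that(1-3), of x y] that(4-) by (simp add: line_def)
  have "projective_plane V ?L"
    unfolding projective_plane_def
  proof (intro conjI ballI impI)
    show "finite V" by (rule finite_V)
    show "?L \<subseteq> Pow V" by (auto simp: line_def)
    show "2 \<le> card l" if "l \<in> ?L" for l using that reg r by auto
  next
    fix u v assume uv: "u \<in> V" "v \<in> V" "u \<noteq> v"
    obtain x where x: "S u \<inter> S v = {x}" using common_element[OF uv] .
    have "line x \<in> ?L \<and> u \<in> line x \<and> v \<in> line x"
      using x uv S_subset_U[OF uv(1)] by (auto simp: line_def)
    then show "\<exists>!l. l \<in> ?L \<and> u \<in> l \<and> v \<in> l"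
      using line_eq[OF uv] by blast
  next
    fix l m assume "l \<in> ?L" "m \<in> ?L" "l \<noteq> m"
    then show "\<exists>x\<in>V. x \<in> l \<and> x \<in> m"
      using lines_meet[OF reg] by (force simp: line_def)
  next
    \<comment> \<open>For the quadrangle, take two lines through \<open>p\<close> and two further
      points on each: \<open>a\<close>, \<open>b\<close> on \<open>line x\<close> and
      \<open>c\<close>, \<open>d\<close> on \<open>line y\<close>. These two lines have only
      \<open>p\<close> in common.\<close>
    obtain p where p: "p \<in> V" using V by blast
    obtain x y where xy: "x \<in> S p" "y \<in> S p" "x \<noteq> y"
      using two_elements[of "S p"] card_S[OF p] r by auto
    have U: "x \<in> U" "y \<in> U" using xy S_subset_U[OF p] by auto
    have two: "\<exists>a b. a \<in> line z \<and> b \<in> line z \<and> a \<noteq> b \<and> a \<noteq> p \<and> b \<noteq> p" if "z \<in> U" for z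
    proof -
      have "card (line z - {p}) \<ge> 2"
        using reg[OF that] r diff_card_le_card_Diff[of "{p}" "line z"] by simp
      then obtain a b where "a \<in> line z - {p}" "b \<in> line z - {p}" "a \<noteq> b"
        by (rule two_elements)
      then show ?thesis by blast
    qed
    obtain a b where ab: "a \<in> line x" "b \<in> line x" "a \<noteq> b" "a \<noteq> p" "b \<noteq> p"
      using two[OF U(1)] by blast
    obtain c d where cd: "c \<in> line y" "d \<in> line y" "c \<noteq> d" "c \<noteq> p" "d \<noteq> p"
      using two[OF U(2)] by blast
    have disj: "q = p" if "q \<in> line x" "q \<in> line y" for q
      using common_element_unique[of p q x y] p xy that by (auto simp: line_def)
    have V4: "a \<in> V" "b \<in> V" "c \<in> V" "d \<in> V" using ab cd by (auto simp: line_def)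
    have ne: "a \<noteq> c" "a \<noteq> d" "b \<noteq> c" "b \<noteq> d" using ab cd disj by auto
    show "\<exists>Q\<subseteq>V. card Q = 4 \<and> (\<forall>T\<subseteq>Q. card T = 3 \<longrightarrow> \<not> (\<exists>l\<in>?L. T \<subseteq> l))"
    proof (intro exI conjI allI impI notI)
      show "{a, b, c, d} \<subseteq> V" using V4 by simp
      show "card {a, b, c, d} = 4" using ab(3) cd(3) ne by simp
      fix T assume T: "T \<subseteq> {a, b, c, d}" "card T = 3" "\<exists>l\<in>?L. T \<subseteq> l"
      then obtain z where z: "T \<subseteq> line z" by blast
      have small: "\<not> T \<subseteq> {q, q'}" for q q' 
        using card_mono[of "{q, q'}" T] T(2) card_insert_le_m1[of 2 "{q'}" q] by auto
      \<comment> \<open>Three of the four points include both chosen points of one line and at least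
        one of the other. A line containing them equals the first line and so meets the second
        outside \<open>p\<close>.\<close>
      have "a \<in> T \<and> b \<in> T \<and> (c \<in> T \<or> d \<in> T) \<or> c \<in> T \<and> d \<in> T \<and> (a \<in> T \<or> b \<in> T)"
        using T(1) small[of a c] small[of a d] small[of b c] small[of b d] small[of a b]
          small[of c d] by blast
      then show False
      proof (elim disjE conjE)
        assume *: "a \<in> T" "b \<in> T"
        then have "line z = line x" using z ab V4 line_eq[of a b z x] by blast
        moreover assume "c \<in> T"
        ultimately show False using disj[of c] z cd by blast
      next
        assume *: "a \<in> T" "b \<in> T"
        then have "line z = line x" using z ab V4 line_eq[of a b z x] by blast
        moreover assume "d \<in> T"
        ultimately show False using disj[of d] z cd by blast
      next
        assume *: "c \<in> T" "d \<in> T"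
        then have "line z = line y" using z cd V4 line_eq[of c d z y] by blast
        moreover assume "a \<in> T"
        ultimately show False using disj[of a] z ab by blast
      next
        assume *: "c \<in> T" "d \<in> T"
        then have "line z = line y" using z cd V4 line_eq[of c d z y] by blast
        moreover assume "b \<in> T"
        ultimately show False using disj[of b] z ab by blast
      qed
    qed
  qed
  moreover have through: "{l \<in> ?L. v \<in> l} = line ` S v" if "v \<in> V" for v
    using that S_subset_U[OF that] by (auto simp: line_def)
  have "card {l \<in> ?L. v \<in> l} = r - 1 + 1" if "v \<in> V" for v
    unfolding through[OF that]
    using card_image[OF inj_on_subset[OF inj S_subset_U[OF that]]] card_S[OF that] r by simp
  moreover have "card ?L = card V" using card_image[OF inj] card_U by simp
  ultimately have "projective_plane_of_order (r - 1) V ?L"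
    using r reg regular_card[OF reg V] by (auto simp: projective_plane_of_order_def)
  \<comment> \<open>Each line is named by the element it came from; this is well defined since
    \<open>line\<close> is injective on \<open>U\<close>.\<close>
  moreover have "inj_on (inv_into U line) ?L" by (rule inj_on_inv_into) simp
  moreover have "S v = inv_into U line ` {l \<in> ?L. v \<in> l}" if "v \<in> V" for v
    unfolding through[OF that] using inv_into_image_cancel[OF inj S_subset_U[OF that]] by simp
  ultimately show ?thesis unfolding type_P_def by blast
qed

section \<open>Minimal unions and deficient lines\<close>

lemma card_line_le_of_no_star:
  assumes no_star: "\<not> (\<exists>c. \<forall>v\<in>V. c \<in> S v)" and x: "x \<in> U"
  shows "card (line x) \<le> r"
proof -
  obtain v where "v \<in> V" "x \<notin> S v" using no_star by blast
  then show ?thesis by (rule card_line_le)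
qed

lemma card_V_le_card_U:
  assumes V: "V \<noteq> {}"
  shows "card V \<le> card U"
proof (cases "\<exists>c. \<forall>v\<in>V. c \<in> S v")
  case True
  then obtain c where "\<And>v. v \<in> V \<Longrightarrow> c \<in> S v" by blast
  from star_imp_type_N(1)[OF this V] show ?thesis by simp
next
  case False
  have "card V * r = (\<Sum>x\<in>U. card (line x))" by (simp add: sum_card_line)
  also have "\<dots> \<le> card U * r"
    using sum_bounded_above[of U "\<lambda>x. card (line x)" r] card_line_le_of_no_star[OF False] by simp
  finally show ?thesis using r_ge_2 by simp
qed

text \<open>A star is excluded by its strict bound. The line sizes then sum to the value obtained
  when each equals its upper bound \<open>r\<close>, so every one attains it.\<close>

lemma regular_if_card_eq:
  assumes V: "V \<noteq> {}" and card_U: "card U = card V" and x: "x \<in> U"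
  shows "card (line x) = r"
proof -
  have no_star: "\<not> (\<exists>c. \<forall>v\<in>V. c \<in> S v)"
    using star_imp_type_N(1)[OF _ V] card_U by fastforce
  have "(\<Sum>x\<in>U. card (line x)) = (\<Sum>x\<in>U. r)" by (simp add: sum_card_line card_U)
  then show ?thesis
    using sum_mono_inv[of "\<lambda>x. card (line x)" U "\<lambda>_. r"] card_line_le_of_no_star[OF no_star]
      finite_U x by blast
qed

lemma deficiency_one:
  assumes V: "card V \<ge> 2" and card_U: "card U = card V + 1"
    and no_star: "\<not> (\<exists>c. \<forall>v\<in>V. c \<in> S v)"
  defines "e \<equiv> \<lambda>x. int r - int (card (line x))"
  shows "\<And>x. x \<in> U \<Longrightarrow> e x \<in> {0, 1}" "(\<Sum>x\<in>U. e x) = int r"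
    "\<And>v. v \<in> V \<Longrightarrow> (\<Sum>x\<in>S v. e x) = 1"
proof -
  \<comment> \<open>By \<open>sum_card_line_S\<close> this is the total deficiency along any one set
    \<open>S v\<close>, whatever \<open>v\<close> is.\<close>
  define c where "c = int r * (int r - 1) - (int (card V) - 1)"
  have e_nonneg: "e x \<ge> 0" if "x \<in> U" for x
    using card_line_le_of_no_star[OF no_star that] by (simp add: e_def)
  have "(\<Sum>x\<in>U. int (card (line x))) = int (card V) * int r"
    using arg_cong[OF sum_card_line, of int] by simp
  then show sum_e: "(\<Sum>x\<in>U. e x) = int r"
    by (simp add: e_def sum_subtractf card_U algebra_simps)
  have sum_e_S: "(\<Sum>x\<in>S v. e x) = c" if v: "v \<in> V" for v
  proof -
    have "(\<Sum>x\<in>S v. e x) = (\<Sum>x\<in>S v. (int r - 1) - (int (card (line x)) - 1))"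
      by (intro sum.cong) (auto simp: e_def)
    also have "\<dots> = c" unfolding sum_subtractf[of "\<lambda>_. int r - 1"] sum_card_line_S[OF v]
      by (simp add: c_def card_S[OF v])
    finally show ?thesis .
  qed
  \<comment> \<open>Double counting of \<open>e\<close> over incident pairs: \<open>x\<close> occurs
    \<open>r - e x\<close> times, which brings in the squares.\<close>
  have "int (card V) * c = (\<Sum>v\<in>V. \<Sum>x\<in>S v. e x)" by (simp add: sum_e_S)
  also have "\<dots> = (\<Sum>x\<in>U. int r * e x - e x * e x)"
    by (simp add: sum_incidence e_def algebra_simps)
  also have "\<dots> = int r * int r - (\<Sum>x\<in>U. e x * e x)"
    unfolding sum_subtractf sum_distrib_left[symmetric] sum_e by simp
  finally have key: "(\<Sum>x\<in>U. e x * e x) = int r * int r - int (card V) * c" by simp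
  have ge: "e x \<le> e x * e x" if "x \<in> U" for x
    using e_nonneg[OF that] mult_right_mono[of 1 "e x" "e x"] by (cases "e x = 0") auto
  have "int r \<le> (\<Sum>x\<in>U. e x * e x)"
    using sum_mono[of U e "\<lambda>x. e x * e x"] ge sum_e by simp
  \<comment> \<open>Since \<open>r * r - r\<close> equals \<open>c\<close> plus
    \<open>card V - 1\<close>, the inequality between \<open>r\<close> and the sum of squares turns
    into this one.\<close>
  then have "(int (card V) - 1) * c \<le> (int (card V) - 1) * 1"
    using key by (simp add: c_def algebra_simps)
  then have "c \<le> 1" using V mult_le_cancel_left_pos[of "int (card V) - 1" c 1] by simp
  moreover have "c > 0"
  proof (rule ccontr)
    obtain v where v: "v \<in> V" using V by fastforce
    have e_lt: "e x < int r" if "x \<in> U" for x using card_line_pos[OF that] by (simp add: e_def)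
    obtain x where x: "x \<in> U" "e x > 0"
      using sum_nonpos[of U e] sum_e r_ge_2 by (metis linorder_not_less not_numeral_le_zero of_nat_le_0_iff)
    \<comment> \<open>Lines are nonempty, so each \<open>e x\<close> is below \<open>r\<close>; an
      \<open>x\<close> with positive deficiency makes the comparison strict.\<close>
    have "(\<Sum>x\<in>U. e x * e x) < (\<Sum>x\<in>U. int r * e x)"
    proof (rule sum_strict_mono_ex1[OF finite_U])
      show "\<forall>x\<in>U. e x * e x \<le> int r * e x"
        using e_nonneg e_lt by (meson less_imp_le mult_right_mono)
      show "\<exists>x\<in>U. e x * e x < int r * e x" using x e_lt by (auto intro!: bexI[of _ x])
    qed
    also have "\<dots> = int r * int r" unfolding sum_distrib_left[symmetric] sum_e ..
    finally have "int (card V) * c > 0" using key by simp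
    moreover assume "\<not> c > 0"
    ultimately show False by (simp add: zero_less_mult_iff)
  qed
  ultimately have c: "c = 1" by simp
  show "(\<Sum>x\<in>S v. e x) = 1" if "v \<in> V" for v using sum_e_S[OF that] c by simp
  \<comment> \<open>With \<open>c = 1\<close> the sum of squares drops to \<open>r\<close>, the sum
    of the deficiencies themselves. Termwise equality of \<open>e x\<close> and its square leaves
    only 0 and 1.\<close>
  have "int (card V) = int r * int r - int r" using c unfolding c_def by (simp add: algebra_simps)
  then have "(\<Sum>x\<in>U. e x * e x) = int r" using key c by simp
  then have eq: "(\<Sum>x\<in>U. e x) = (\<Sum>x\<in>U. e x * e x)" using sum_e by simp
  show "e x \<in> {0, 1}" if "x \<in> U" for x
    using sum_mono_inv[OF eq ge that finite_U] by simp
qed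

text \<open>
  By \<open>deficiency_one\<close> the lines that are one point short partition the vertices; adding the
  point \<^const>\<open>None\<close> to each of them makes the family regular.
\<close>

lemma card_Suc_imp_type_P_minus:
  assumes V: "card V \<ge> 3" and card_U: "card U = card V + 1"
    and no_star: "\<not> (\<exists>c. \<forall>v\<in>V. c \<in> S v)"
  shows "r \<ge> 3" "card V = (r - 1)\<^sup>2 + (r - 1)" "type_P_minus (r - 1) V S"
proof -
  define e where "e x = int r - int (card (line x))" for x
  have V2: "card V \<ge> 2" using V by simp
  have e01: "e x \<in> {0, 1}" if "x \<in> U" for x
    unfolding e_def by (rule deficiency_one(1)[OF V2 card_U no_star that])
  have sum_e: "(\<Sum>x\<in>U. e x) = int r"
    unfolding e_def by (rule deficiency_one(2)[OF V2 card_U no_star])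
  have sum_e_S: "(\<Sum>x\<in>S v. e x) = 1" if "v \<in> V" for v
    unfolding e_def by (rule deficiency_one(3)[OF V2 card_U no_star that])
  define B where "B = {x \<in> U. e x = 1}"
  have sum_card: "(\<Sum>x\<in>A. e x) = int (card (A \<inter> B))" if "A \<subseteq> U" for A
  proof -
    have "finite A" by (rule finite_subset[OF that finite_U])
    have "(\<Sum>x\<in>A. e x) = (\<Sum>x\<in>A. if x \<in> B then 1 else 0)"
      using e01 that by (intro sum.cong) (auto simp: B_def)
    also have "\<dots> = int (card (A \<inter> B))"
      using \<open>finite A\<close> by (simp add: sum.If_cases Int_def)
    finally show ?thesis .
  qed
  have B: "B \<subseteq> U" by (auto simp: B_def)
  have card_B: "card B = r" using sum_card[of U] sum_e B by (simp add: Int_absorb1)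
  have card_SB: "card (S v \<inter> B) = 1" if "v \<in> V" for v
    using sum_card[OF S_subset_U[OF that]] sum_e_S[OF that] by simp
  \<comment> \<open>\<open>B\<close> is the set representing the new point: it has \<open>r\<close>
    elements because the deficiencies sum to \<open>r\<close>, and it meets each \<open>S v\<close>
    once because they sum to 1 there. The extended family has the same union as the old one.\<close>
  define V' where "V' = insert None (Some ` V)"
  define S' where "S' = case_option B S"
  have S'_simps: "S' None = B" "\<And>v. S' (Some v) = S v" by (auto simp: S'_def)
  have Int_commute_card: "card (B \<inter> S v) = 1" if "v \<in> V" for v
    using card_SB[OF that] by (simp add: Int_commute)
  interpret P: clique_family V' S' r
  proof
    show "finite V'" using finite_V by (simp add: V'_def)
    show "card (S' v) = r" if "v \<in> V'" for v
      using that card_S card_B by (auto simp: V'_def S'_simps)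
    show "card (S' u \<inter> S' v) = 1" if "u \<in> V'" "v \<in> V'" "u \<noteq> v" for u v
      using that card_SB Int_commute_card
      by (auto simp: V'_def S'_simps) (metis One_nat_def card_Int)
  qed (rule r_ge_2)
  have U': "P.U = U" 
    using B unfolding P.U_def U_def by (auto simp: V'_def S'_simps)
  have line': "P.line x = (if x \<in> B then {None} else {}) \<union> Some ` line x" for x
    unfolding P.line_def line_def by (auto simp: V'_def S'_simps)
  have reg: "card (P.line x) = r" if "x \<in> P.U" for x
  proof (cases "x \<in> B")
    case True
    then have "e x = 1" by (simp add: B_def)
    moreover have "card (insert None (Some ` line x)) = Suc (card (line x))"
      using finite_line by (subst card_insert_disjoint) (auto simp: card_image)
    ultimately show ?thesis using True by (simp add: line' e_def)
  next
    case False
    then have "e x = 0" using e01[of x] that U' by (auto simp: B_def)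
    then show ?thesis using False by (simp add: line' e_def card_image)
  qed
  have ne: "V' \<noteq> {}" by (simp add: V'_def)
  have card_V': "card V' = card V + 1"
    using finite_V by (simp add: V'_def card_image)
  have eq: "card V + 1 = (r - 1)\<^sup>2 + (r - 1) + 1"
    using P.regular_card[OF reg ne] card_V' by simp
  then show "card V = (r - 1)\<^sup>2 + (r - 1)" by simp
  \<comment> \<open>For \<open>r = 2\<close> the count would give \<open>card V = 2\<close>.\<close>
  show r: "r \<ge> 3"
  proof (rule ccontr)
    assume "\<not> r \<ge> 3"
    then have "r = 2" using r_ge_2 by simp
    then show False using eq V by simp
  qed
  have "type_P (r - 1) V' S'"
    using P.regular_imp_type_P[OF reg _ r ne] U' card_V' card_U by simp
  then show "type_P_minus (r - 1) V S"
    unfolding type_P_def type_P_minus_def V'_def by (auto simp: S'_simps)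
qed

text \<open>The regular count forces \<open>r = 2\<close>, and three distinct pairs inside a
  three-element union are all of its pairs.\<close>

lemma type_T_if_card_3:
  assumes V: "card V = 3" and card_U: "card U = 3"
  shows "type_T V S"
proof -
  have ne: "V \<noteq> {}" using V by auto
  have "3 = (r - 1)\<^sup>2 + (r - 1) + 1"
    using regular_card[OF regular_if_card_eq[OF ne] ne] V card_U by simp
  moreover have "(r - 1)\<^sup>2 \<ge> 2\<^sup>2" if "r \<ge> 3" using that by (intro power_mono) auto
  ultimately have r: "r = 2" using r_ge_2 by fastforce
  obtain a b c where abc: "U = {a, b, c}" "distinct [a, b, c]"
    using card_U by (auto simp: card_3_iff)
  have "inj_on S V"
  proof (rule inj_onI, rule ccontr)
    fix u v assume "u \<in> V" "v \<in> V" "S u = S v" "u \<noteq> v"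
    then show False using card_Int[of u v] card_S[of v] r by simp
  qed
  then have card: "card (S ` V) = 3" using V by (simp add: card_image)
  have "S ` V \<subseteq> {{a, b}, {a, c}, {b, c}}"
  proof
    fix s assume "s \<in> S ` V"
    then have "s \<subseteq> {a, b, c}" "card s = 2" using S_subset_U card_S r abc(1) by auto
    then show "s \<in> {{a, b}, {a, c}, {b, c}}" by (auto simp: card_2_iff)
  qed
  moreover have "card {{a, b}, {a, c}, {b, c}} = 3"
    using abc(2) by (auto simp: doubleton_eq_iff)
  ultimately have "S ` V = {{a, b}, {a, c}, {b, c}}"
    using card by (intro card_subset_eq) auto
  then show ?thesis using abc(2) unfolding type_T_def by blast
qed

end

section \<open>Complete graphs as clique families, and explicit representations\<close>

lemma adjacent_iff_complete:
  assumes "K\<^bsub>n\<^esub> G" "u \<in> verts G" "v \<in> verts G"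
  shows "u \<rightarrow>\<^bsub>G\<^esub> v \<longleftrightarrow> u \<noteq> v"
  using assms by (auto simp: complete_digraph_def)

text \<open>Distinctness enters here: two singletons with a common element would coincide, so the
  common size is at least 2.\<close>

lemma clique_family_if_uniform:
  assumes K: "K\<^bsub>n\<^esub> G" and n: "n \<ge> 2" and S: "uniform_representation G S"
  obtains r where "clique_family (verts G) S r"
proof -
  have fin: "finite (verts G)" using K n by (intro card_ge_0_finite) (auto simp: complete_digraph_def)
  obtain u v where uv: "u \<in> verts G" "v \<in> verts G" "u \<noteq> v"
    using two_elements[of "verts G"] K n by (auto simp: complete_digraph_def)
  have int: "card (S x \<inter> S y) = 1" if "x \<in> verts G" "y \<in> verts G" "x \<noteq> y" for x y
    using that S adjacent_iff_complete[OF K]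
    by (simp add: uniform_representation_def representation_def)
  have fS: "finite (S x)" "S x \<noteq> {}" if "x \<in> verts G" for x
    using that S by (auto simp: uniform_representation_def representation_def)
  have card: "card (S x) = card (S u)" if "x \<in> verts G" for x
    using S that uv unfolding uniform_representation_def by blast
  have "card (S u) \<noteq> 0" using fS uv by simp
  moreover have "card (S u) \<noteq> 1"
  proof
    assume "card (S u) = 1"
    moreover from this have "card (S v) = 1" using card[OF uv(2)] by simp
    ultimately have "S u = S v"
      using int[OF uv] by (auto simp: card_1_singleton_iff Int_insert_left split: if_splits)
    then show False using S uv by (auto simp: uniform_representation_def inj_on_def)
  qed
  ultimately have "card (S u) \<ge> 2" by linarith
  with fin have "clique_family (verts G) S (card (S u))"
    by unfold_locales (assumption | rule card int)+
  then show ?thesis by (rule that)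
qed

lemma uniform_if_clique_family:
  assumes K: "K\<^bsub>n\<^esub> G" and S: "clique_family (verts G) S r"
  shows "uniform_representation G S"
proof -
  interpret clique_family "verts G" S r by fact
  have "S v \<noteq> {}" if "v \<in> verts G" for v using card_S[OF that] r_ge_2 by auto
  moreover have "inj_on S (verts G)"
  proof (rule inj_onI, rule ccontr)
    fix u v assume "u \<in> verts G" "v \<in> verts G" "S u = S v" "u \<noteq> v"
    then show False using card_Int[of u v] card_S[of v] r_ge_2 by simp
  qed
  ultimately show ?thesis
    using finite_S card_S card_Int adjacent_iff_complete[OF K]
    by (simp add: uniform_representation_def representation_def)
qed

text \<open>The map \<open>e\<close> places the indices among the points and may miss one point
  \<open>p\<close>. This covers both plane types, with \<open>e\<close> being \<open>id\<close> for
  (P) and \<open>Some\<close> for (P\<open>^-\<close>).\<close>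

lemma clique_family_plane:
  assumes plane: "projective_plane_of_order k P L" and f: "inj_on f L"
    and e: "inj_on e V" "e ` V \<subseteq> P" and P: "P \<subseteq> insert p (e ` V)"
  defines "S \<equiv> \<lambda>v. f ` {l \<in> L. e v \<in> l}"
  shows "clique_family V S (k + 1)" "card (\<Union>v\<in>V. S v) = k\<^sup>2 + k + 1"
proof -
  have fin: "finite P" and sub: "\<And>l. l \<in> L \<Longrightarrow> l \<subseteq> P"
    and line: "\<And>x y. x \<in> P \<Longrightarrow> y \<in> P \<Longrightarrow> x \<noteq> y \<Longrightarrow> \<exists>!l. l \<in> L \<and> x \<in> l \<and> y \<in> l"
    and k: "k \<ge> 2" and card_L: "card L = k\<^sup>2 + k + 1" and card_l: "\<And>l. l \<in> L \<Longrightarrow> card l = k + 1"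
    and deg: "\<And>x. x \<in> P \<Longrightarrow> card {l \<in> L. x \<in> l} = k + 1"
    using plane unfolding projective_plane_of_order_def projective_plane_def by auto
  have card_f: "card (f ` M) = card M" if "M \<subseteq> L" for M
    by (rule card_image[OF inj_on_subset[OF f that]])
  show "clique_family V S (k + 1)"
  proof
    show "finite V" using finite_subset[OF e(2) fin] e(1) by (rule finite_imageD)
    show "2 \<le> k + 1" using k by simp
    show "card (S v) = k + 1" if "v \<in> V" for v
      unfolding S_def using deg e(2) that by (subst card_f) auto
    fix u v assume uv: "u \<in> V" "v \<in> V" "u \<noteq> v"
    then have "e u \<in> P" "e v \<in> P" "e u \<noteq> e v" using e by (auto dest: inj_onD)
    from line[OF this] obtain l where l: "{l \<in> L. e u \<in> l} \<inter> {l \<in> L. e v \<in> l} = {l}" by blast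
    have "S u \<inter> S v = f ` ({l \<in> L. e u \<in> l} \<inter> {l \<in> L. e v \<in> l})"
      unfolding S_def by (rule inj_on_image_Int[OF f, symmetric]) auto
    then show "card (S u \<inter> S v) = 1" by (simp add: l)
  qed
  \<comment> \<open>A line has two points and at most one is missed, so dropping \<open>p\<close>
    loses no line from the union.\<close>
  have "\<exists>v\<in>V. e v \<in> l" if l: "l \<in> L" for l
  proof -
    have "2 \<le> card l" using card_l[OF l] k by simp
    then obtain x y where "x \<in> l" "y \<in> l" "x \<noteq> y" by (rule two_elements)
    then show ?thesis using sub[OF l] P by blast
  qed
  then have "(\<Union>v\<in>V. S v) = f ` L" unfolding S_def by blast
  then show "card (\<Union>v\<in>V. S v) = k\<^sup>2 + k + 1" using card_f[of L] card_L by simp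
qed

text \<open>An injective renaming of points preserves and reflects incidence (\<open>mem\<close>).
  It serves to carry a plane on natural numbers over to a prescribed point set.\<close>

lemma projective_plane_of_order_image:
  assumes plane: "projective_plane_of_order k P L" and h: "inj_on h P"
  shows "projective_plane_of_order k (h ` P) ((`) h ` L)"
proof -
  have fin: "finite P" and LP: "L \<subseteq> Pow P" and two: "\<And>l. l \<in> L \<Longrightarrow> card l \<ge> 2"
    and line: "\<And>x y. x \<in> P \<Longrightarrow> y \<in> P \<Longrightarrow> x \<noteq> y \<Longrightarrow> \<exists>!l. l \<in> L \<and> x \<in> l \<and> y \<in> l"
    and meet: "\<And>l m. l \<in> L \<Longrightarrow> m \<in> L \<Longrightarrow> l \<noteq> m \<Longrightarrow> \<exists>x\<in>P. x \<in> l \<and> x \<in> m"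
    and quad: "\<exists>Q\<subseteq>P. card Q = 4 \<and> (\<forall>T\<subseteq>Q. card T = 3 \<longrightarrow> \<not> (\<exists>l\<in>L. T \<subseteq> l))"
    using plane unfolding projective_plane_of_order_def projective_plane_def by auto
  have order: "k \<ge> 2" "card P = k\<^sup>2 + k + 1" "card L = k\<^sup>2 + k + 1" "\<And>l. l \<in> L \<Longrightarrow> card l = k + 1"
    "\<And>x. x \<in> P \<Longrightarrow> card {l \<in> L. x \<in> l} = k + 1"
    using plane unfolding projective_plane_of_order_def by auto
  have sub: "l \<subseteq> P" if "l \<in> L" for l using that LP by blast
  have card_h: "card (h ` A) = card A" if "A \<subseteq> P" for A
    by (rule card_image[OF inj_on_subset[OF h that]])
  have mem: "h x \<in> h ` l \<longleftrightarrow> x \<in> l" if "x \<in> P" "l \<in> L" for x l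
    using inj_on_image_mem_iff[OF h that(1) sub[OF that(2)]] .
  have inj_L: "inj_on ((`) h) L"
    using inj_on_image_Pow[OF h] LP by (rule inj_on_subset)
  have "projective_plane (h ` P) ((`) h ` L)"
    unfolding projective_plane_def
  proof (intro conjI ballI impI)
    show "finite (h ` P)" using fin by simp
    show "(`) h ` L \<subseteq> Pow (h ` P)" using sub by blast
    show "2 \<le> card l" if "l \<in> (`) h ` L" for l
      using that two card_h sub by auto
  next
    fix x' y' assume "x' \<in> h ` P" "y' \<in> h ` P" "x' \<noteq> y'"
    then obtain x y where xy: "x \<in> P" "y \<in> P" "x' = h x" "y' = h y" "x \<noteq> y" by blast
    obtain l where l: "l \<in> L" "x \<in> l" "y \<in> l"
      and uniq: "\<And>m. m \<in> L \<Longrightarrow> x \<in> m \<Longrightarrow> y \<in> m \<Longrightarrow> m = l"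
      using line[OF xy(1,2,5)] by blast
    show "\<exists>!l. l \<in> (`) h ` L \<and> x' \<in> l \<and> y' \<in> l"
    proof (rule ex1I[of _ "h ` l"])
      show "h ` l \<in> (`) h ` L \<and> x' \<in> h ` l \<and> y' \<in> h ` l" using l xy by blast
      fix m' assume "m' \<in> (`) h ` L \<and> x' \<in> m' \<and> y' \<in> m'"
      then obtain m where "m' = h ` m" "m \<in> L" "h x \<in> h ` m" "h y \<in> h ` m"
        unfolding xy(3,4) by (elim conjE imageE) simp
      then show "m' = h ` l" using uniq[of m] mem xy(1,2) by simp
    qed
  next
    fix l' m' assume "l' \<in> (`) h ` L" "m' \<in> (`) h ` L" "l' \<noteq> m'"
    then obtain l m where "l \<in> L" "m \<in> L" "l \<noteq> m" "l' = h ` l" "m' = h ` m" by blast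
    then show "\<exists>x\<in>h ` P. x \<in> l' \<and> x \<in> m'" using meet[of l m] by blast
  next
    obtain Q where Q: "Q \<subseteq> P" "card Q = 4"
      and no_line: "\<forall>T\<subseteq>Q. card T = 3 \<longrightarrow> \<not> (\<exists>l\<in>L. T \<subseteq> l)"
      using quad by (elim exE conjE)
    have no: "\<not> T \<subseteq> l" if "T \<subseteq> Q" "card T = 3" "l \<in> L" for T l
      using no_line that by blast
    show "\<exists>Q\<subseteq>h ` P. card Q = 4 \<and> (\<forall>T\<subseteq>Q. card T = 3 \<longrightarrow> \<not> (\<exists>l\<in>(`) h ` L. T \<subseteq> l))"
    proof (intro exI[of _ "h ` Q"] conjI allI impI notI)
      show "h ` Q \<subseteq> h ` P" "card (h ` Q) = 4" using Q card_h by auto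
      fix T' assume T': "T' \<subseteq> h ` Q" "card T' = 3" "\<exists>l\<in>(`) h ` L. T' \<subseteq> l"
      obtain T where T: "T \<subseteq> Q" "T' = h ` T" using T'(1) by (auto simp: subset_image_iff)
      obtain l where l: "l \<in> L" "h ` T \<subseteq> h ` l" using T'(3) T(2) by blast
      have "T \<subseteq> P" using T Q by blast
      then have "T \<subseteq> l" using mem[OF _ l(1)] l(2) by blast
      then show False using no[OF T(1) _ l(1)] T'(2) T(2) card_h[OF \<open>T \<subseteq> P\<close>] by simp
    qed
  qed
  moreover have "card {l \<in> (`) h ` L. h x \<in> l} = k + 1" if x: "x \<in> P" for x
  proof -
    have "{l \<in> (`) h ` L. h x \<in> l} = (`) h ` {l \<in> L. x \<in> l}" using mem[OF x] by blast
    then show ?thesis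
      using card_image[OF inj_on_subset[OF inj_L, of "{l \<in> L. x \<in> l}"]] order(5)[OF x] by auto
  qed
  moreover have "card ((`) h ` L) = k\<^sup>2 + k + 1" using card_image[OF inj_L] order(3) by simp
  moreover have "card (h ` P) = k\<^sup>2 + k + 1" using card_h[of P] order(2) by simp
  moreover have "card (h ` l) = k + 1" if "l \<in> L" for l
    using card_h[OF sub[OF that]] order(4)[OF that] by simp
  ultimately show ?thesis using order(1) by (auto simp: projective_plane_of_order_def)
qed

text \<open>The numbering \<open>f\<close> of the lines turns the pencil of a point into a set of
  natural numbers, the element type of the witnesses for (P\<open>^-\<close>).\<close>

lemma projective_plane_exists_on:
  assumes ex: "projective_plane_exists k" and fin: "finite A" and card: "card A = k\<^sup>2 + k + 1"
  obtains L and f :: "'a set \<Rightarrow> nat" where "projective_plane_of_order k A L" "inj_on f L"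
proof -
  obtain P :: "nat set" and M where M: "projective_plane_of_order k P M"
    using ex by (auto simp: projective_plane_exists_def)
  then have "finite P" "card P = card A"
    using card by (auto simp: projective_plane_of_order_def projective_plane_def)
  then obtain h where "bij_betw h P A" using finite_same_card_bij fin by blast
  then have A: "projective_plane_of_order k A ((`) h ` M)"
    using projective_plane_of_order_image[OF M, of h] by (simp add: bij_betw_def)
  then have "finite ((`) h ` M)"
    by (intro card_ge_0_finite) (simp add: projective_plane_of_order_def)
  from finite_imp_inj_to_nat_seg[OF this]
  obtain f :: "'a set \<Rightarrow> nat" where "inj_on f ((`) h ` M)"
    by blast
  with A show ?thesis by (rule that)
qed

text \<open>The common element is 0; \<open>Suc\<close> keeps the private elements away from
  it.\<close>

lemma clique_family_star:
  fixes g :: "'v \<Rightarrow> nat"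
  assumes fin: "finite V" and g: "inj_on g V" and V: "V \<noteq> {}"
  defines "S \<equiv> \<lambda>v. {0, Suc (g v)}"
  shows "clique_family V S 2" "card (\<Union>v\<in>V. S v) = card V + 1" "type_N V S"
proof -
  show "clique_family V S 2"
  proof
    show "card (S u \<inter> S v) = 1" if "u \<in> V" "v \<in> V" "u \<noteq> v" for u v
    proof -
      have "S u \<inter> S v = {0}" using inj_onD[OF g _ that(1,2)] that(3) by (auto simp: S_def)
      then show ?thesis by simp
    qed
  qed (auto simp: S_def fin)
  have "(\<Union>v\<in>V. S v) = insert 0 (Suc ` g ` V)" using V by (auto simp: S_def)
  then show "card (\<Union>v\<in>V. S v) = card V + 1"
    using fin g by (simp add: card_image)
  show "type_N V S" unfolding type_N_def S_def
    using g by (intro exI[of _ 0] exI[of _ "Suc \<circ> g"]) (auto simp: inj_on_def)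
qed

text \<open>Each vertex receives the names of the two others, so two sets share exactly the name of
  the third vertex.\<close>

lemma clique_family_triangle:
  assumes V: "card V = 3" and g: "inj_on g V"
  defines "S \<equiv> \<lambda>v. g ` (V - {v})"
  shows "clique_family V S 2" "card (\<Union>v\<in>V. S v) = 3"
proof -
  have fin: "finite V" using V by (intro card_ge_0_finite) simp
  have card_g: "card (g ` A) = card A" if "A \<subseteq> V" for A
    by (rule card_image[OF inj_on_subset[OF g that]])
  show "clique_family V S 2"
  proof
    show "card (S v) = 2" if "v \<in> V" for v
      using that V fin by (simp add: S_def card_g)
    show "card (S u \<inter> S v) = 1" if "u \<in> V" "v \<in> V" "u \<noteq> v" for u v
    proof -
      have "S u \<inter> S v = g ` ((V - {u}) \<inter> (V - {v}))"
        unfolding S_def by (rule inj_on_image_Int[OF g, symmetric]) auto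
      also have "(V - {u}) \<inter> (V - {v}) = V - {u, v}" by auto
      finally show ?thesis using that V fin by (simp add: card_g card_Diff_subset)
    qed
  qed (simp_all add: fin)
  have "card V \<ge> 2" using V by simp
  then obtain x y where "x \<in> V" "y \<in> V" "x \<noteq> y" by (rule two_elements)
  then have "(\<Union>v\<in>V. S v) = g ` V" unfolding S_def by blast
  then show "card (\<Union>v\<in>V. S v) = 3" using card_g[of V] V by simp
qed

section \<open>Arithmetic of the orders, and separation of the types\<close>

lemma pronic_eq_iff:
  fixes j k :: nat
  shows "j\<^sup>2 + j = k\<^sup>2 + k \<longleftrightarrow> j = k"
proof -
  have "j\<^sup>2 + j < k\<^sup>2 + k" if "j < k" for j k :: nat
    using that power_mono[of j k 2] by linarith
  then show ?thesis by (metis less_irrefl linorder_neqE_nat)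
qed

text \<open>A parity argument; it keeps the cases (P) and (P\<open>^-\<close>) from occurring for
  the same number of vertices.\<close>

lemma pronic_ne_Suc_pronic:
  fixes j k :: nat
  shows "k\<^sup>2 + k \<noteq> j\<^sup>2 + j + 1"
proof -
  have "even (k\<^sup>2 + k)" "odd (j\<^sup>2 + j + 1)" by simp_all
  then show ?thesis by metis
qed

lemma type_N_card: "type_N V S \<Longrightarrow> v \<in> V \<Longrightarrow> card (S v) = 2"
  by (auto simp: type_N_def)

text \<open>The sets are pencils of size \<open>k + 1\<close> with \<open>k \<ge> 2\<close>. Against
  the pairs of \<open>type_N_card\<close> this makes the two types exclusive.\<close>

lemma type_P_minus_card:
  assumes "type_P_minus k V S" "v \<in> V"
  shows "card (S v) \<ge> 3"
proof -
  obtain L and f where L: "projective_plane_of_order k (insert None (Some ` V)) L"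
    and f: "inj_on f L" "S v = f ` {l \<in> L. Some v \<in> l}"
    using assms unfolding type_P_minus_def by blast
  have "card (S v) = card {l \<in> L. Some v \<in> l}"
    unfolding f(2) by (intro card_image inj_on_subset[OF f(1)]) auto
  also have "\<dots> = k + 1" using L assms(2) by (auto simp: projective_plane_of_order_def)
  finally show ?thesis using L by (simp add: projective_plane_of_order_def)
qed

section \<open>Lower bound and extremal cases for complete graphs\<close>

lemma card_ge_complete:
  assumes K: "K\<^bsub>n\<^esub> G" and n: "n \<ge> 3" and S: "uniform_representation G S"
  shows "n \<le> card (\<Union>v\<in>verts G. S v)"
proof -
  obtain r where "clique_family (verts G) S r"
    using clique_family_if_uniform[OF K _ S] n by auto
  then interpret clique_family "verts G" S r .
  have "verts G \<noteq> {}" "card (verts G) = n" using K n by (auto simp: complete_digraph_def)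
  then show ?thesis using card_V_le_card_U by (simp add: U_def)
qed

lemma card_eq_complete:
  assumes K: "K\<^bsub>n\<^esub> G" and n: "n \<ge> 4" and S: "uniform_representation G S"
    and card: "card (\<Union>v\<in>verts G. S v) = n"
  obtains k where "k \<ge> 2" "n = k\<^sup>2 + k + 1" "type_P k (verts G) S"
proof -
  obtain r where "clique_family (verts G) S r"
    using clique_family_if_uniform[OF K _ S] n by auto
  then interpret clique_family "verts G" S r .
  have ne: "verts G \<noteq> {}" and cV: "card (verts G) = n" using K n by (auto simp: complete_digraph_def)
  have cU: "card U = card (verts G)" using card cV by (simp add: U_def)
  note reg = regular_if_card_eq[OF ne cU]
  have eq: "n = (r - 1)\<^sup>2 + (r - 1) + 1" using regular_card[OF reg ne] cV by simp
  \<comment> \<open>For \<open>r = 2\<close> the count gives \<open>n = 3\<close>, the triangle,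
    which \<open>n \<ge> 4\<close> rules out.\<close>
  have r: "r \<ge> 3"
  proof (rule ccontr)
    assume "\<not> r \<ge> 3"
    then have "r = 2" using r_ge_2 by simp
    then show False using eq n by simp
  qed
  show ?thesis
    using that[OF _ eq regular_imp_type_P[OF reg cU r ne]] r by simp
qed

lemma card_Suc_complete:
  assumes K: "K\<^bsub>n\<^esub> G" and n: "n \<ge> 3" and S: "uniform_representation G S"
    and card: "card (\<Union>v\<in>verts G. S v) = n + 1"
  shows "type_N (verts G) S \<or> (\<exists>k\<ge>2. n = k\<^sup>2 + k \<and> type_P_minus k (verts G) S)"
proof -
  obtain r where "clique_family (verts G) S r"
    using clique_family_if_uniform[OF K _ S] n by auto
  then interpret clique_family "verts G" S r .
  have ne: "verts G \<noteq> {}" and cV: "card (verts G) = n" using K n by (auto simp: complete_digraph_def)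
  have cU: "card U = card (verts G) + 1" using card cV by (simp add: U_def)
  show ?thesis
  proof (cases "\<exists>c. \<forall>v\<in>verts G. c \<in> S v")
    case True
    then obtain c where "\<And>v. v \<in> verts G \<Longrightarrow> c \<in> S v" by blast
    from star_imp_type_N(2)[OF this ne] show ?thesis using cU by simp
  next
    case False
    have V: "card (verts G) \<ge> 3" using cV n by simp
    have "r - 1 \<ge> 2" using card_Suc_imp_type_P_minus(1)[OF V cU False] by simp
    then show ?thesis using card_Suc_imp_type_P_minus(2,3)[OF V cU False] cV by blast
  qed
qed

theorem theorem3p4:
  fixes G :: "('v, 'e) pre_digraph" and n :: nat
  assumes "K\<^bsub>n\<^esub> G" and "n \<ge> 3"
  shows
    "(n = 3 \<longrightarrow>
        omega_u G = 3 \<and>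
        (\<forall>S :: 'v \<Rightarrow> 'b set. min_uniform_representation G S \<longrightarrow> type_T (verts G) S))
     \<and>
     (\<forall>k\<ge>2. n \<ge> 4 \<and> n = k\<^sup>2 + k + 1 \<and> projective_plane_exists k \<longrightarrow>
        omega_u G = n \<and>
        (\<forall>S :: 'v \<Rightarrow> 'b set. min_uniform_representation G S \<longrightarrow> type_P k (verts G) S))
     \<and>
     (\<forall>k\<ge>2. n \<ge> 4 \<and> n = k\<^sup>2 + k \<and> projective_plane_exists k \<longrightarrow>
        omega_u G = n + 1 \<and>
        (\<forall>S :: 'v \<Rightarrow> 'b set. min_uniform_representation G S \<longrightarrow>
           (type_N (verts G) S \<or> type_P_minus k (verts G) S) \<and>
           \<not> (type_N (verts G) S \<and> type_P_minus k (verts G) S)) \<and>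
        (\<exists>S :: 'v \<Rightarrow> nat set. min_uniform_representation G S \<and> type_N (verts G) S) \<and>
        (\<exists>S :: 'v \<Rightarrow> nat set. min_uniform_representation G S \<and> type_P_minus k (verts G) S))
     \<and>
     (n \<ge> 4 \<and> (\<forall>k\<ge>2. n \<noteq> k\<^sup>2 + k + 1 \<and> n \<noteq> k\<^sup>2 + k) \<longrightarrow>
        omega_u G = n + 1 \<and>
        (\<forall>S :: 'v \<Rightarrow> 'b set. min_uniform_representation G S \<longrightarrow> type_N (verts G) S))"
proof -
  let ?V = "verts G"
  have graph: "graph G" and cV: "card ?V = n" using assms(1) by (auto simp: complete_digraph_def)
  have fin: "finite ?V" and ne: "?V \<noteq> {}"
    using assms(2) cV by (auto intro: card_ge_0_finite)
  obtain g :: "'v \<Rightarrow> nat" where g: "inj_on g ?V"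
    using finite_imp_inj_to_nat_seg[OF fin] by blast
  note uniform = uniform_if_clique_family[OF assms(1)]
  obtain S0 :: "'v \<Rightarrow> nat set" where S0: "uniform_representation G S0"
    and omega: "omega_u G = card (\<Union>v\<in>?V. S0 v)"
    using omega_u_attained[OF graph] by (auto simp: min_uniform_representation_def)
  have lower: "n \<le> omega_u G"
    unfolding omega by (rule card_ge_complete[OF assms S0])
  define N :: "'v \<Rightarrow> nat set" where "N v = {0, Suc (g v)}" for v
  have N: "uniform_representation G N" "card (\<Union>v\<in>?V. N v) = n + 1" "type_N ?V N"
    using clique_family_star[OF fin g ne] uniform cV unfolding N_def by auto
  have upper: "omega_u G \<le> n + 1"
    using omega_u_le[OF fin N(1)] N(2) by simp
  \<comment> \<open>A representation on only \<open>n\<close> elements would give \<open>n\<close>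
    the form excluded here, so between the bounds \<open>n\<close> and \<open>n + 1\<close> only the
    latter remains.\<close>
  have not_plane: "omega_u G = n + 1" if "n \<ge> 4" "\<And>k. k \<ge> 2 \<Longrightarrow> n \<noteq> k\<^sup>2 + k + 1"
  proof -
    have "omega_u G \<noteq> n"
      using card_eq_complete[OF assms(1) that(1) S0] that(2) omega by metis
    then show ?thesis using lower upper by simp
  qed
  have case1: "omega_u G = 3 \<and>
      (\<forall>S :: 'v \<Rightarrow> 'b set. min_uniform_representation G S \<longrightarrow> type_T ?V S)" if n: "n = 3"
  proof -
    have V: "card ?V = 3" using cV n by simp
    have "omega_u G \<le> 3"
      using omega_u_le[OF fin uniform[OF clique_family_triangle(1)[OF V g]]]
        clique_family_triangle(2)[OF V g] by simp
    then have w: "omega_u G = 3" using lower n by simp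
    moreover have "type_T ?V S" if "min_uniform_representation G S" for S :: "'v \<Rightarrow> 'b set"
    proof -
      have S: "uniform_representation G S" "card (\<Union>v\<in>?V. S v) = 3"
        using that w by (auto simp: min_uniform_representation_def)
      obtain r where "clique_family ?V S r"
        using clique_family_if_uniform[OF assms(1) _ S(1)] n by auto
      from clique_family.type_T_if_card_3[OF this V] show ?thesis
        using S(2) by (simp add: clique_family.U_def[OF \<open>clique_family ?V S r\<close>])
    qed
    ultimately show ?thesis by blast
  qed
  have case2: "omega_u G = n \<and>
      (\<forall>S :: 'v \<Rightarrow> 'b set. min_uniform_representation G S \<longrightarrow> type_P k ?V S)"
    if k: "k \<ge> 2" "n \<ge> 4" "n = k\<^sup>2 + k + 1" "projective_plane_exists k" for k
  proof -
    have V: "card ?V = k\<^sup>2 + k + 1" using cV k(3) by simp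
    obtain L and f :: "'v set \<Rightarrow> nat" where L: "projective_plane_of_order k ?V L" "inj_on f L"
      using projective_plane_exists_on[OF k(4) fin V] .
    \<comment> \<open>Here \<open>id\<close> reaches every point, so the exceptional point may be
      arbitrary.\<close>
    have "?V \<subseteq> insert undefined (id ` ?V)" by auto
    note * = clique_family_plane[OF L inj_on_id _ this]
    have "omega_u G \<le> n"
      using omega_u_le[OF fin uniform[OF *(1)]] *(2) k(3) by simp
    then have w: "omega_u G = n" using lower by simp
    moreover have "type_P k ?V S" if "min_uniform_representation G S" for S :: "'v \<Rightarrow> 'b set"
    proof -
      have S: "uniform_representation G S" "card (\<Union>v\<in>?V. S v) = n"
        using that w by (auto simp: min_uniform_representation_def)
      \<comment> \<open>The order \<open>j\<close> found from the representation agrees with the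
        given \<open>k\<close>, since both yield the same \<open>n\<close>.\<close>
      obtain j where j: "n = j\<^sup>2 + j + 1" "type_P j ?V S"
        using card_eq_complete[OF assms(1) k(2) S] by blast
      then have "j = k" using k(3) pronic_eq_iff[of j k] by simp
      then show ?thesis using j by simp
    qed
    ultimately show ?thesis by blast
  qed
  have case3: "omega_u G = n + 1 \<and>
      (\<forall>S :: 'v \<Rightarrow> 'b set. min_uniform_representation G S \<longrightarrow>
         (type_N ?V S \<or> type_P_minus k ?V S) \<and> \<not> (type_N ?V S \<and> type_P_minus k ?V S)) \<and>
      (\<exists>S :: 'v \<Rightarrow> nat set. min_uniform_representation G S \<and> type_N ?V S) \<and>
      (\<exists>S :: 'v \<Rightarrow> nat set. min_uniform_representation G S \<and> type_P_minus k ?V S)"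
    if k: "k \<ge> 2" "n \<ge> 4" "n = k\<^sup>2 + k" "projective_plane_exists k" for k
  proof (intro conjI allI impI)
    show w: "omega_u G = n + 1"
      using not_plane[OF k(2)] pronic_ne_Suc_pronic k(3) by metis
    show "\<exists>S :: 'v \<Rightarrow> nat set. min_uniform_representation G S \<and> type_N ?V S"
      using N w by (auto simp: min_uniform_representation_def)
    \<comment> \<open>With \<open>None\<close> added there are \<open>n + 1\<close> points, the
      number of points of a plane of order \<open>k\<close>.\<close>
    let ?P = "insert None (Some ` ?V)"
    have P: "finite ?P" "card ?P = k\<^sup>2 + k + 1"
      using fin cV k(3) by (simp_all add: card_image)
    obtain L and f :: "'v option set \<Rightarrow> nat" where L: "projective_plane_of_order k ?P L" "inj_on f L"
      using projective_plane_exists_on[OF k(4) P] .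
    define S :: "'v \<Rightarrow> nat set" where "S v = f ` {l \<in> L. Some v \<in> l}" for v
    have "clique_family ?V S (k + 1)" "card (\<Union>v\<in>?V. S v) = k\<^sup>2 + k + 1"
      using clique_family_plane[OF L, of Some ?V None] unfolding S_def by auto
    then have "min_uniform_representation G S"
      using w k(3) uniform by (simp add: min_uniform_representation_def)
    moreover have "type_P_minus k ?V S" using L unfolding type_P_minus_def S_def by blast
    ultimately show "\<exists>S :: 'v \<Rightarrow> nat set. min_uniform_representation G S \<and> type_P_minus k ?V S"
      by blast
  next
    fix S :: "'v \<Rightarrow> 'b set"
    obtain v where v: "v \<in> ?V" using ne by blast
    show "\<not> (type_N ?V S \<and> type_P_minus k ?V S)"
      using type_N_card[of ?V S v] type_P_minus_card[of k ?V S v] v by auto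
    assume "min_uniform_representation G S"
    then have S: "uniform_representation G S" "card (\<Union>v\<in>?V. S v) = n + 1"
      using not_plane[OF k(2)] pronic_ne_Suc_pronic k(3)
      by (auto simp: min_uniform_representation_def)
    show "type_N ?V S \<or> type_P_minus k ?V S"
      using card_Suc_complete[OF assms S] k(3) pronic_eq_iff by metis
  qed
  have case4: "omega_u G = n + 1 \<and>
      (\<forall>S :: 'v \<Rightarrow> 'b set. min_uniform_representation G S \<longrightarrow> type_N ?V S)"
    if "n \<ge> 4" "\<forall>k\<ge>2. n \<noteq> k\<^sup>2 + k + 1 \<and> n \<noteq> k\<^sup>2 + k"
  proof -
    have w: "omega_u G = n + 1" using not_plane that by blast
    moreover have "type_N ?V S" if "min_uniform_representation G S" for S :: "'v \<Rightarrow> 'b set"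
      using card_Suc_complete[OF assms, of S] that w \<open>\<forall>k\<ge>2. _ k\<close>
      by (auto simp: min_uniform_representation_def)
    ultimately show ?thesis by blast
  qed
  show ?thesis using case1 case2 case3 case4 by blast
qed

end
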